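(* Let $m,n\geq 3$ be integers. The disjoint union $C_m\sqcup C_n$ is realizable in $\mathbb{R}$ if and only if $(m,n)\neq(3,3)$.
   Context: Graphs are finite and simple; $C_k$ is the cycle with $k$ vertices, and $\sqcup$ denotes disjoint union. For a graph $G=(V,E)$ and a total order $\prec$ on $E$, we say that $\prec$ is realizable in $\mathbb{R}$ if there is an injection $p\colon V\to\mathbb{R}$ such that the edge lengths $|p(u)-p(v)|$, $uv\in E$, are pairwise distinct and, for all distinct edges $uv,xy\in E$, $uv\prec xy$ if and only if $|p(u)-p(v)|<|p(x)-p(y)|$. The graph $G$ is called realizable in $\mathbb{R}$ if every total order on $E(G)$ is realizable in $\mathbb{R}$. *)

theory Defs
  imports Complex_Main
begin

record 'a graph =
  verts :: "'a set"
  edges :: "'a set set"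

definition simple_graph :: "'a graph \<Rightarrow> bool" where
  "simple_graph G \<longleftrightarrow>
     finite (verts G) \<and> (\<forall>e\<in>edges G. e \<subseteq> verts G \<and> card e = 2)"

text \<open>The following is the cycle with \<open>k\<close> vertices for \<open>k \<ge> 3\<close>; smaller \<open>k\<close> is not meaningful.\<close>

definition cycle_graph :: "nat \<Rightarrow> nat graph" where
  "cycle_graph k = \<lparr> verts = {..<k}, edges = {{i, (i + 1) mod k} | i. i < k} \<rparr>"

definition disjoint_union :: "'a graph \<Rightarrow> 'b graph \<Rightarrow> ('a + 'b) graph" where
  "disjoint_union G H =
     \<lparr> verts = verts G <+> verts H,
       edges = (\<lambda>e. Inl ` e) ` edges G \<union> (\<lambda>e. Inr ` e) ` edges H \<rparr>"

text \<open>A total order on the edges is given by its strict part \<open>r\<close>, a set of pairs of edges.\<close>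

definition order_realizable :: "'a graph \<Rightarrow> 'a set rel \<Rightarrow> bool" where
  "order_realizable G r \<longleftrightarrow>
     (\<exists>p :: 'a \<Rightarrow> real. inj_on p (verts G) \<and>
        (\<forall>u v x y. {u, v} \<in> edges G \<longrightarrow> {x, y} \<in> edges G \<longrightarrow> {u, v} \<noteq> {x, y} \<longrightarrow>
           \<bar>p u - p v\<bar> \<noteq> \<bar>p x - p y\<bar> \<and>
           (({u, v}, {x, y}) \<in> r \<longleftrightarrow> \<bar>p u - p v\<bar> < \<bar>p x - p y\<bar>)))"

definition realizable :: "'a graph \<Rightarrow> bool" where
  "realizable G \<longleftrightarrow>
     (\<forall>r. r \<subseteq> edges G \<times> edges G \<longrightarrow> strict_linear_order_on (edges G) r \<longrightarrow>
        order_realizable G r)"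

lemma simple_graph_cycle_graph:
  assumes "3 \<le> k"
  shows "simple_graph (cycle_graph k)"
proof -
  have "i \<noteq> Suc i mod k" if "i < k" for i
    using that assms by (cases "Suc i = k") auto
  moreover have "Suc i mod k < k" for i
    using assms by simp
  ultimately show ?thesis
    by (auto simp: simple_graph_def cycle_graph_def card_2_iff)
qed

lemma simple_graph_disjoint_union:
  assumes "simple_graph G" "simple_graph H"
  shows "simple_graph (disjoint_union G H)"
  using assms unfolding simple_graph_def disjoint_union_def
  by (auto simp: card_image)

end

theory Submission
  imports Defs
begin

text \<open>
  A cycle placed on the line is a cyclic sequence of signed edge lengths with sum \<open>0\<close>, and the
  placement is injective when no proper arc has sum \<open>0\<close>. Only the first condition is a real
  constraint: adding a small \<open>\<epsilon>\<close> to every signed length but one, and correcting that one, destroys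
  all vanishing arc sums while keeping all strict inequalities between lengths
  (\<open>order_realizable_of_balanced_lengths\<close>). The question therefore becomes: given an order on
  \<open>m\<close> edges \<open>A\<close> and \<open>n\<close> edges \<open>B\<close>, are there signs and lengths in this order such that
  the signed lengths of \<open>A\<close> and those of \<open>B\<close> both sum to \<open>0\<close>?

  For two triangles the answer can be negative. If \<open>a\<^sub>1 < b\<^sub>1 < a\<^sub>2 < b\<^sub>2 < b\<^sub>3 < a\<^sub>3\<close>, then
  \<open>a\<^sub>3 = a\<^sub>1 + a\<^sub>2 < b\<^sub>1 + b\<^sub>2 = b\<^sub>3\<close>, a contradiction.

  Otherwise, read the edges from the longest to the shortest. A choice of signs turns this
  reading into a lattice walk in the plane that starts at the origin: an edge of \<open>A\<close> moves the
  first coordinate by its sign, an edge of \<open>B\<close> the second one. If \<open>d\<^sub>t > 0\<close> is the gap between the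
  length of the \<open>t\<close>-th edge and that of the next one (or \<open>0\<close>, after the last), then summation by
  parts shows that the two signed sums are the coordinates of \<open>\<Sum> d\<^sub>t w\<^sub>t\<close>, where \<open>w\<^sub>t\<close> is the
  walk after \<open>t\<close> steps (\<open>walk_signs_times_tails\<close>). Thus it suffices to choose signs for which
  the points \<open>w\<^sub>t\<close> generate the whole plane as a cone: then any surplus can be compensated and
  strictly positive gaps exist (\<open>positive_dependence\<close>). Further points never hurt, so it is enough
  to look at an initial part of the reading that contains exactly three edges of one cycle, say
  \<open>A\<close>, and \<open>n \<ge> 4\<close> edges of the other (\<open>prefix_with_three_hits\<close>).

  Let the first coordinate run through \<open>0, 1, 0, - 1\<close>. The points visited in the columns \<open>1\<close> and
  \<open>- 1\<close> make the cone horizontally unbounded in both directions, so one only needs points of the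
  cone on the vertical axis on both sides of the origin. These are the points visited in
  the column \<open>0\<close>, together with the sums of a point in the column \<open>1\<close> and one in the column \<open>- 1\<close>.
  Three simple choices of the second coordinate, \<open>0, 1, 0, - 1, - 2, \<dots>\<close> or \<open>0, 1, 0, - 1, 0, - 1, \<dots>\<close>
  or \<open>0, 1, 2, 1, 0, - 1, 0, \<dots>\<close>, cover all cases (\<open>walk_on_both_sides\<close>).
\<close>

section \<open>Counting along an order\<close>

definition hits :: "(nat \<Rightarrow> bool) \<Rightarrow> nat \<Rightarrow> nat" where
  "hits c t = card {i. i < t \<and> c i}"

lemma hits_0 [simp]: "hits c 0 = 0"
  by (simp add: hits_def)

lemma hits_Suc [simp]: "hits c (Suc t) = (if c t then Suc (hits c t) else hits c t)"
proof -
  have "{i. i < Suc t \<and> c i} = (if c t then insert t {i. i < t \<and> c i} else {i. i < t \<and> c i})"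
    by (auto simp: less_Suc_eq)
  then show ?thesis
    by (simp add: hits_def)
qed

lemma hits_complement: "hits c t + hits (\<lambda>i. \<not> c i) t = t"
  by (induction t) auto

lemma hits_mono: "s \<le> t \<Longrightarrow> hits c s \<le> hits c t"
  by (induction t) (auto simp: le_Suc_eq)

lemma last_hit:
  assumes "hits c M = Suc a"
  shows "\<exists>T<M. hits c T = a \<and> (\<forall>t. T < t \<and> t \<le> M \<longrightarrow> hits c t = Suc a)"
  using assms
proof (induction M)
  case (Suc M)
  show ?case
  proof (cases "c M")
    case True
    with Suc.prems show ?thesis
      by (intro exI[of _ M]) (auto simp: less_Suc_eq_le dest!: order_antisym)
  next
    case False
    with Suc.prems obtain T where "T < M" "hits c T = a"
      "\<forall>t. T < t \<and> t \<le> M \<longrightarrow> hits c t = Suc a"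
      using Suc.IH by auto
    with Suc.prems show ?thesis
      by (intro exI[of _ T]) (auto simp del: hits_Suc simp: le_Suc_eq)
  qed
qed simp

text \<open>
  The lattice path of a reading with three hits, cut into its four columns: \<open>i\<close>, \<open>j\<close> and \<open>k\<close>
  count the misses before the first, second and third hit. After \<open>a\<close> hits and \<open>s\<close> misses
  the time is \<open>s + a\<close>, so \<open>hits c (s + a) = a\<close> says that the path visits the point
  with these two counts.
\<close>

lemma three_hits:
  assumes "hits c (n + 3) = 3"
  obtains i j k where "i \<le> j" "j \<le> k" "k \<le> n"
    "\<And>s. s \<le> i \<Longrightarrow> hits c s = 0"
    "\<And>s. i \<le> s \<Longrightarrow> s \<le> j \<Longrightarrow> hits c (s + 1) = 1"
    "\<And>s. j \<le> s \<Longrightarrow> s \<le> k \<Longrightarrow> hits c (s + 2) = 2"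
    "\<And>s. k \<le> s \<Longrightarrow> s \<le> n \<Longrightarrow> hits c (s + 3) = 3"
proof -
  obtain T3 where T3: "T3 < n + 3" "hits c T3 = 2"
    "\<And>t. T3 < t \<Longrightarrow> t \<le> n + 3 \<Longrightarrow> hits c t = 3"
    using last_hit[of c "n + 3" 2] assms by (auto simp: numeral_3_eq_3 numeral_2_eq_2)
  obtain T2 where T2: "T2 < T3" "hits c T2 = 1"
    "\<And>t. T2 < t \<Longrightarrow> t \<le> T3 \<Longrightarrow> hits c t = 2"
    using last_hit[of c T3 1] T3(2) by (auto simp: numeral_2_eq_2)
  obtain T1 where T1: "T1 < T2" "hits c T1 = 0"
    "\<And>t. T1 < t \<Longrightarrow> t \<le> T2 \<Longrightarrow> hits c t = 1"
    using last_hit[of c T2 0] T2(2) by auto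
  show thesis
  proof (rule that[of T1 "T2 - 1" "T3 - 2"])
    show "hits c s = 0" if "s \<le> T1" for s
      using hits_mono[OF that, of c] T1(2) by simp
    show "hits c (s + 1) = 1" if "T1 \<le> s" "s \<le> T2 - 1" for s
      using T1 that by (intro T1(3)) auto
    show "hits c (s + 2) = 2" if "T2 - 1 \<le> s" "s \<le> T3 - 2" for s
      using T1 T2(1) that by (intro T2(3)) auto
    show "hits c (s + 3) = 3" if "T3 - 2 \<le> s" "s \<le> n" for s
      using T1(1) T2(1) that by (intro T3(3)) auto
  qed (use T1(1) T2(1) T3(1) in auto)
qed

text \<open>
  Stop at the first time when both counts are at least \<open>3\<close> and not both equal to \<open>3\<close>: one step
  earlier this failed, which forces one of the counts to be \<open>3\<close> exactly.
\<close>

lemma prefix_with_three_hits: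
  assumes "3 \<le> hits c N" "3 \<le> hits (\<lambda>i. \<not> c i) N"
    and "\<not> (hits c N = 3 \<and> hits (\<lambda>i. \<not> c i) N = 3)"
  shows "\<exists>M\<le>N. hits c M = 3 \<and> 4 \<le> hits (\<lambda>i. \<not> c i) M
    \<or> hits (\<lambda>i. \<not> c i) M = 3 \<and> 4 \<le> hits c M"
  using assms
proof (induction N)
  case (Suc N)
  show ?case
  proof (cases "3 \<le> hits c N \<and> 3 \<le> hits (\<lambda>i. \<not> c i) N
      \<and> \<not> (hits c N = 3 \<and> hits (\<lambda>i. \<not> c i) N = 3)")
    case True
    with Suc.IH show ?thesis
      by (meson le_SucI)
  next
    case False
    with Suc.prems show ?thesis
      by (intro exI[of _ "Suc N"]) (auto split: if_splits)
  qed
qed simp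

section \<open>Walks with unit steps\<close>

definition unit_walk :: "(nat \<Rightarrow> real) \<Rightarrow> bool" where
  "unit_walk y \<longleftrightarrow> y 0 = 0 \<and> (\<forall>s. \<bar>y (Suc s) - y s\<bar> = 1)"

definition tent :: "nat \<Rightarrow> real" where
  "tent s = (if s = 0 then 0 else 2 - real s)"

lemma unit_walk_tent: "unit_walk tent"
  by (auto simp: unit_walk_def tent_def)

text \<open>
  Suppose that the first coordinate takes the values \<open>0\<close>, \<open>1\<close>, \<open>0\<close>, \<open>- 1\<close> while the
  second one, \<open>y\<close>, is at the times up to \<open>i\<close>, from \<open>i\<close> to \<open>j\<close>, from \<open>j\<close> to \<open>k\<close>, and from
  \<open>k\<close> to \<open>n\<close>. The heights below are those at which the vertical axis is met by
  the visited points themselves or by the sum of a point with first coordinate \<open>1\<close> and one with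
  first coordinate \<open>- 1\<close>.
\<close>

definition axis_height :: "(nat \<Rightarrow> real) \<Rightarrow> nat \<Rightarrow> nat \<Rightarrow> nat \<Rightarrow> nat \<Rightarrow> real \<Rightarrow> bool" where
  "axis_height y i j k n v \<longleftrightarrow>
     (\<exists>s. (s \<le> i \<or> j \<le> s \<and> s \<le> k) \<and> v = y s) \<or>
     (\<exists>s t. i \<le> s \<and> s \<le> j \<and> k \<le> t \<and> t \<le> n \<and> v = y s + y t)"

lemma axis_height_pointI:
  "s \<le> i \<or> j \<le> s \<and> s \<le> k \<Longrightarrow> axis_height y i j k n (y s)"
  by (auto simp: axis_height_def)

lemma axis_height_sumI:
  "i \<le> s \<Longrightarrow> s \<le> j \<Longrightarrow> k \<le> t \<Longrightarrow> t \<le> n \<Longrightarrow> axis_height y i j k n (y s + y t)"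
  by (auto simp: axis_height_def)

text \<open>
  The walk \<open>tent\<close> ends so low that \<open>tent i + tent n < 0\<close>; this is where \<open>n \<ge> 4\<close> matters. Its
  only positive value is the peak \<open>tent 1 = 1\<close>, which is of use unless \<open>i = 0\<close>, \<open>j \<ge> 2\<close> and
  \<open>k \<ge> 3\<close>. In that remaining case the times \<open>0\<close>, \<open>1\<close> and \<open>2\<close> all belong to the column \<open>1\<close>,
  and adding the final value \<open>y n\<close>, which is \<open>0\<close> or \<open>- 1\<close> according to parity, to
  values at these times already gives most of what is wanted.
\<close>

lemma walk_on_both_sides:
  assumes le: "i \<le> j" "j \<le> k" "k \<le> n" and n: "4 \<le> n"
  shows "\<exists>y v w. unit_walk y \<and> axis_height y i j k n v \<and> 0 < v
    \<and> axis_height y i j k n w \<and> w < 0"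
proof (cases "1 \<le> i \<or> j \<le> 1 \<or> k \<le> 2")
  case True
  have neg: "axis_height tent i j k n (tent i + tent n)"
    using le by (intro axis_height_sumI) auto
  have "tent i + tent n < 0"
    using n by (auto simp: tent_def)
  have "\<exists>v>0. axis_height tent i j k n v"
  proof -
    consider "1 \<le> i" | "j \<le> 1" "1 \<le> k" | "i = 0" "k = 0" | "i = 0" "2 \<le> j" "k \<le> 2"
      using True le by linarith
    then show ?thesis
    proof cases
      case 1
      then show ?thesis
        using axis_height_pointI[of 1 i j k tent n] by (intro exI[of _ 1]) (simp add: tent_def)
    next
      case 2
      then show ?thesis
        using axis_height_pointI[of 1 i j k tent n] by (intro exI[of _ 1]) (simp add: tent_def)
    next
      case 3
      then show ?thesis
        using axis_height_sumI[of i 0 j k 1 n tent] n by (intro exI[of _ 1]) (simp add: tent_def)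
    next
      case 4
      then show ?thesis
        using axis_height_sumI[of i 1 j k 2 n tent] n by (intro exI[of _ 1]) (simp add: tent_def)
    qed
  qed
  with neg \<open>tent i + tent n < 0\<close> show ?thesis
    using unit_walk_tent by blast
next
  case False
  then have ijk: "i = 0" "2 \<le> j" "3 \<le> k"
    by auto
  show ?thesis
  proof (cases "even n")
    case True
    define y :: "nat \<Rightarrow> real" where
      "y s = (if odd s then if s = 1 then 1 else - 1 else 0)" for s
    have "unit_walk y"
      by (auto simp: unit_walk_def y_def)
    moreover have "axis_height y i j k n (y 1 + y n)"
      using ijk le by (intro axis_height_sumI) auto
    moreover have "0 < y 1 + y n"
      using n True by (simp add: y_def)
    \<comment> \<open>The value \<open>y 3 = - 1\<close> is taken in the column \<open>0\<close> if \<open>j = 2\<close>, and otherwise in the column \<open>1\<close>,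
      where \<open>y n = 0\<close> can be added to it.\<close>
    moreover have "\<exists>w<0. axis_height y i j k n w"
    proof (cases "j = 2")
      case True
      then show ?thesis
        using axis_height_pointI[of 3 i j k y n] ijk by (intro exI[of _ "- 1"]) (simp add: y_def)
    next
      case False
      then show ?thesis
        using axis_height_sumI[of i 3 j k n n y] ijk le \<open>even n\<close>
        by (intro exI[of _ "- 1"]) (simp add: y_def)
    qed
    ultimately show ?thesis
      by blast
  next
    case False
    define y :: "nat \<Rightarrow> real" where
      "y s = (if s = 2 then 2 else if odd s then if s \<le> 3 then 1 else - 1 else 0)" for s
    have "\<bar>y (Suc s) - y s\<bar> = 1" for s
    proof -
      consider "s = 0" | "s = 1" | "s = 2" | "s = 3" | "4 \<le> s"
        by linarith
      then show ?thesis
        by cases (auto simp: y_def)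
    qed
    then have "unit_walk y"
      by (simp add: unit_walk_def y_def)
    moreover have "axis_height y i j k n (y 2 + y n)" "axis_height y i j k n (y 0 + y n)"
      using ijk le by (auto intro: axis_height_sumI)
    moreover have "0 < y 2 + y n" "y 0 + y n < 0"
      using n False by (auto simp: y_def)
    ultimately show ?thesis
      by blast
  qed
qed

section \<open>Positive combinations of planar points\<close>

definition cone :: "nat \<Rightarrow> (nat \<Rightarrow> real) \<Rightarrow> (nat \<Rightarrow> real) \<Rightarrow> (real \<times> real) set" where
  "cone N f g = {(\<Sum>t=1..N. d t * f t, \<Sum>t=1..N. d t * g t) | d. \<forall>t. 0 \<le> d t}"

lemma cone_point:
  assumes "t \<in> {1..N}"
  shows "(f t, g t) \<in> cone N f g"
proof -
  have "(\<Sum>s=1..N. of_bool (s = t) * h s) = h t" for h :: "nat \<Rightarrow> real"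
    using assms by (simp add: of_bool_def if_distrib[of "\<lambda>x. x * _"] cong: if_cong)
  then show ?thesis
    unfolding cone_def by (auto intro!: exI[of _ "\<lambda>s. of_bool (s = t)"])
qed

lemma cone_add:
  assumes "(u, v) \<in> cone N f g" "(u', v') \<in> cone N f g"
  shows "(u + u', v + v') \<in> cone N f g"
proof -
  obtain d e where "\<forall>t. 0 \<le> d t" "u = (\<Sum>t=1..N. d t * f t)" "v = (\<Sum>t=1..N. d t * g t)"
    "\<forall>t. 0 \<le> e t" "u' = (\<Sum>t=1..N. e t * f t)" "v' = (\<Sum>t=1..N. e t * g t)"
    using assms unfolding cone_def by blast
  then show ?thesis
    unfolding cone_def
    by (auto intro!: exI[of _ "\<lambda>t. d t + e t"] simp: distrib_right sum.distrib)
qed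

lemma cone_scale:
  assumes "(u, v) \<in> cone N f g" "0 \<le> a"
  shows "(a * u, a * v) \<in> cone N f g"
proof -
  obtain d where "\<forall>t. 0 \<le> d t" "u = (\<Sum>t=1..N. d t * f t)" "v = (\<Sum>t=1..N. d t * g t)"
    using assms unfolding cone_def by blast
  with assms(2) show ?thesis
    unfolding cone_def
    by (auto intro!: exI[of _ "\<lambda>t. a * d t"] simp: sum_distrib_left mult.assoc)
qed

text \<open>
  The two points on the vertical axis generate that axis, and with it every point of a
  vertical line that contains a point of the cone.
\<close>

lemma cone_eq_UNIV:
  assumes "(1, p) \<in> cone N f g" "(- 1, q) \<in> cone N f g"
    and "(0, v) \<in> cone N f g" "0 < v" "(0, w) \<in> cone N f g" "w < 0"
  shows "cone N f g = UNIV"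
proof -
  have vertical: "(0, b) \<in> cone N f g" for b
  proof (cases "0 \<le> b")
    case True
    then show ?thesis
      using cone_scale[OF assms(3), of "b / v"] assms(4) by simp
  next
    case False
    then show ?thesis
      using cone_scale[OF assms(5), of "b / w"] assms(6) by (simp add: divide_nonpos_neg)
  qed
  have "(a, b) \<in> cone N f g" for a b
  proof (cases "0 \<le> a")
    case True
    then show ?thesis
      using cone_add[OF cone_scale[OF assms(1) True] vertical[of "b - a * p"]] by simp
  next
    case False
    then show ?thesis
      using cone_add[OF cone_scale[OF assms(2), of "- a"] vertical[of "b + a * q"]] by simp
  qed
  then show ?thesis
    by auto
qed

text \<open>
  Give every point the weight \<open>1\<close> and cancel the resulting sum by an element of the cone; the
  total weights stay positive.
\<close>

lemma positive_dependence:
  assumes "cone N f g = UNIV"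
  shows "\<exists>d. (\<forall>t. 0 < d t) \<and> (\<Sum>t=1..N. d t * f t) = 0 \<and> (\<Sum>t=1..N. d t * g t) = 0"
proof -
  have "(- (\<Sum>t=1..N. f t), - (\<Sum>t=1..N. g t)) \<in> cone N f g"
    using assms by simp
  then obtain d where "\<forall>t. 0 \<le> d t" "(\<Sum>t=1..N. d t * f t) = - (\<Sum>t=1..N. f t)"
    "(\<Sum>t=1..N. d t * g t) = - (\<Sum>t=1..N. g t)"
    unfolding cone_def by auto
  then show ?thesis
    by (intro exI[of _ "\<lambda>t. d t + 1"]) (auto simp: distrib_right sum.distrib add_nonneg_pos)
qed

section \<open>Balanced lengths in a prescribed order\<close>

text \<open>
  The weights \<open>d\<close> are the future gaps between consecutive lengths. The points of the walk
  beyond the first \<open>M\<close> steps only enlarge the cone, so a prefix that generates the plane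
  suffices, whatever the continuation of the two walks.
\<close>

lemma balanced_gaps_three:
  assumes "M \<le> N" "hits c M = 3" "4 \<le> hits (\<lambda>i. \<not> c i) M"
  shows "\<exists>x y d. unit_walk x \<and> unit_walk y \<and> (\<forall>t. 0 < d t) \<and>
    (\<Sum>t=1..N. d t * x (hits c t)) = 0 \<and> (\<Sum>t=1..N. d t * y (hits (\<lambda>i. \<not> c i) t)) = 0"
proof -
  define n where "n = hits (\<lambda>i. \<not> c i) M"
  have M: "M = n + 3"
    using hits_complement[of c M] assms(2) by (simp add: n_def)
  then have "hits c (n + 3) = 3"
    using assms(2) by simp
  then obtain i j k where ijk: "i \<le> j" "j \<le> k" "k \<le> n"
    and h: "\<And>s. s \<le> i \<Longrightarrow> hits c s = 0"
      "\<And>s. i \<le> s \<Longrightarrow> s \<le> j \<Longrightarrow> hits c (s + 1) = 1"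
      "\<And>s. j \<le> s \<Longrightarrow> s \<le> k \<Longrightarrow> hits c (s + 2) = 2"
      "\<And>s. k \<le> s \<Longrightarrow> s \<le> n \<Longrightarrow> hits c (s + 3) = 3"
    by (rule three_hits) blast
  obtain y v w where y: "unit_walk y"
    and v: "axis_height y i j k n v" "0 < v" and w: "axis_height y i j k n w" "w < 0"
    using walk_on_both_sides[OF ijk] assms(3) n_def by blast
  define K where "K = cone N (\<lambda>t. tent (hits c t)) (\<lambda>t. y (hits (\<lambda>i. \<not> c i) t))"
  have visit: "(tent a, y s) \<in> K" if "hits c (s + a) = a" "0 < s + a" "s \<le> n" "a \<le> 3" for a s
  proof -
    have "hits (\<lambda>i. \<not> c i) (s + a) = s"
      using hits_complement[of c "s + a"] that(1) by simp
    then show ?thesis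
      using cone_point[of "s + a" N "\<lambda>t. tent (hits c t)" "\<lambda>t. y (hits (\<lambda>i. \<not> c i) t)"]
        that M assms(1) by (simp add: K_def)
  qed
  have right: "(1, y s) \<in> K" if "i \<le> s" "s \<le> j" for s
    using visit[of s 1] h(2)[OF that] that ijk by (simp add: tent_def)
  have left: "(- 1, y s) \<in> K" if "k \<le> s" "s \<le> n" for s
    using visit[of s 3] h(4)[OF that] that by (simp add: tent_def)
  have axis: "(0, u) \<in> K" if "axis_height y i j k n u" "u \<noteq> 0" for u
    using that(1) unfolding axis_height_def
  proof (elim disjE exE conjE)
    fix s assume s: "s \<le> i" "u = y s"
    with that(2) y have "s \<noteq> 0"
      by (auto simp: unit_walk_def intro: ccontr)
    then show ?thesis
      using visit[of s 0] h(1)[OF s(1)] s ijk by (simp add: tent_def)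
  next
    fix s assume "j \<le> s" "s \<le> k" "u = y s"
    then show ?thesis
      using visit[of s 2] h(3)[of s] ijk by (simp add: tent_def)
  next
    fix s t assume "i \<le> s" "s \<le> j" "k \<le> t" "t \<le> n" "u = y s + y t"
    then show ?thesis
      using cone_add right[of s] left[of t] unfolding K_def by fastforce
  qed
  have "K = UNIV"
    using cone_eq_UNIV right[of i] left[of n] axis[OF v(1)] axis[OF w(1)] v(2) w(2) ijk
    unfolding K_def by (metis less_irrefl order_refl)
  then show ?thesis
    using positive_dependence unit_walk_tent y unfolding K_def by blast
qed

lemma balanced_gaps:
  assumes "3 \<le> hits c N" "3 \<le> hits (\<lambda>i. \<not> c i) N"
    and "\<not> (hits c N = 3 \<and> hits (\<lambda>i. \<not> c i) N = 3)"
  shows "\<exists>x y d. unit_walk x \<and> unit_walk y \<and> (\<forall>t. 0 < d t) \<and>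
    (\<Sum>t=1..N. d t * x (hits c t)) = 0 \<and> (\<Sum>t=1..N. d t * y (hits (\<lambda>i. \<not> c i) t)) = 0"
proof -
  obtain M where "M \<le> N" and M: "hits c M = 3 \<and> 4 \<le> hits (\<lambda>i. \<not> c i) M
    \<or> hits (\<lambda>i. \<not> c i) M = 3 \<and> 4 \<le> hits c M"
    using prefix_with_three_hits[OF assms] by blast
  from M show ?thesis
  proof
    assume "hits c M = 3 \<and> 4 \<le> hits (\<lambda>i. \<not> c i) M"
    with \<open>M \<le> N\<close> show ?thesis
      using balanced_gaps_three by blast
  next
    assume "hits (\<lambda>i. \<not> c i) M = 3 \<and> 4 \<le> hits c M"
    with \<open>M \<le> N\<close> show ?thesis
      using balanced_gaps_three[of M N "\<lambda>i. \<not> c i"] by auto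
  qed
qed

text \<open>
  Summation by parts: the tails of \<open>d\<close> are the lengths, and \<open>g\<close> accumulates the signs.
\<close>

lemma sum_increments_times_tails:
  fixes g d :: "nat \<Rightarrow> real"
  assumes "g 0 = 0"
  shows "(\<Sum>i<N. (g (Suc i) - g i) * (\<Sum>t=Suc i..N. d t)) = (\<Sum>t=1..N. d t * g t)"
proof (induction N)
  case (Suc N)
  have "(\<Sum>i<Suc N. (g (Suc i) - g i) * (\<Sum>t=Suc i..Suc N. d t))
    = (\<Sum>i<Suc N. (g (Suc i) - g i) * (\<Sum>t=Suc i..N. d t) + (g (Suc i) - g i) * d (Suc N))"
    by (intro sum.cong) (auto simp: distrib_left)
  also have "\<dots> = (\<Sum>i<N. (g (Suc i) - g i) * (\<Sum>t=Suc i..N. d t))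
      + (\<Sum>i<Suc N. g (Suc i) - g i) * d (Suc N)"
    by (simp add: sum.distrib sum_distrib_right distrib_right)
  also have "(\<Sum>i<Suc N. g (Suc i) - g i) = g (Suc N)"
    using assms by (simp only: sum_lessThan_telescope diff_zero)
  finally show ?case
    using Suc.IH by simp
qed simp

lemma walk_signs_times_tails:
  fixes d :: "nat \<Rightarrow> real"
  assumes "unit_walk x"
  shows "(\<Sum>i | i < N \<and> c i. (x (hits c (Suc i)) - x (hits c i)) * (\<Sum>t=Suc i..N. d t))
    = (\<Sum>t=1..N. d t * x (hits c t))"
proof -
  have "(\<Sum>i | i < N \<and> c i. (x (hits c (Suc i)) - x (hits c i)) * (\<Sum>t=Suc i..N. d t))
    = (\<Sum>i<N. (x (hits c (Suc i)) - x (hits c i)) * (\<Sum>t=Suc i..N. d t))"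
    \<comment> \<open>The count, hence the walk, stands still at the indices outside \<open>c\<close>.\<close>
    by (rule sum.mono_neutral_left) auto
  then show ?thesis
    using sum_increments_times_tails[where g = "\<lambda>t. x (hits c t)" and N = N and d = d] assms
    by (simp add: unit_walk_def del: hits_Suc)
qed

text \<open>
  Index \<open>0\<close> stands for the longest edge, and \<open>c\<close> tells which edges belong to the first
  cycle. The lengths are the tails of the sequence of gaps, and their signs are the increments of
  the two walks.
\<close>

lemma balanced_lengths:
  assumes "3 \<le> hits c N" "3 \<le> hits (\<lambda>i. \<not> c i) N"
    and "\<not> (hits c N = 3 \<and> hits (\<lambda>i. \<not> c i) N = 3)"
  shows "\<exists>l :: nat \<Rightarrow> real. (\<forall>i j. i < j \<and> j < N \<longrightarrow> \<bar>l j\<bar> < \<bar>l i\<bar>) \<and>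
    (\<Sum>i | i < N \<and> c i. l i) = 0 \<and> (\<Sum>i | i < N \<and> \<not> c i. l i) = 0"
proof -
  obtain x y d where x: "unit_walk x" and y: "unit_walk y" and d: "\<And>t. 0 < d t"
    and sums: "(\<Sum>t=1..N. d t * x (hits c t)) = 0"
      "(\<Sum>t=1..N. d t * y (hits (\<lambda>i. \<not> c i) t)) = 0"
    using balanced_gaps[OF assms] by blast
  define len where "len i = (\<Sum>t=Suc i..N. d t)" for i
  define l where "l i = (if c i then x (hits c (Suc i)) - x (hits c i)
    else y (hits (\<lambda>i. \<not> c i) (Suc i)) - y (hits (\<lambda>i. \<not> c i) i)) * len i" for i
  have "0 \<le> len i" for i
    unfolding len_def using d by (intro sum_nonneg less_imp_le)
  then have abs_l: "\<bar>l i\<bar> = len i" for i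
    using x y by (simp add: l_def unit_walk_def abs_mult)
  have "len j < len i" if "i < j" "j < N" for i j
    unfolding len_def
    by (rule sum_strict_mono2[of _ _ "Suc i"]) (use that d in \<open>auto intro: less_imp_le\<close>)
  moreover have "(\<Sum>i | i < N \<and> c i. l i) = 0"
    using walk_signs_times_tails[OF x, where N = N and c = c and d = d] sums(1)
    by (simp add: l_def len_def del: hits_Suc)
  moreover have "(\<Sum>i | i < N \<and> \<not> c i. l i) = 0"
    using walk_signs_times_tails[OF y, where N = N and c = "\<lambda>i. \<not> c i" and d = d] sums(2)
    by (simp add: l_def len_def del: hits_Suc)
  ultimately show ?thesis
    by (intro exI[of _ l]) (simp add: abs_l)
qed

section \<open>From signed lengths to positions\<close>

text \<open>
  Indexing the edges of both cycles by a sum type allows their signed lengths to be treated as one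
  function \<open>case_sum a b\<close>.
\<close>

definition union_edge :: "nat \<Rightarrow> nat \<Rightarrow> nat + nat \<Rightarrow> (nat + nat) set" where
  "union_edge m n \<iota> = (case \<iota> of
     Inl i \<Rightarrow> {Inl i, Inl ((i + 1) mod m)} | Inr i \<Rightarrow> {Inr i, Inr ((i + 1) mod n)})"

abbreviation two_cycles :: "nat \<Rightarrow> nat \<Rightarrow> (nat + nat) graph" where
  "two_cycles m n \<equiv> disjoint_union (cycle_graph m) (cycle_graph n)"

abbreviation edge_indices :: "nat \<Rightarrow> nat \<Rightarrow> (nat + nat) set" where
  "edge_indices m n \<equiv> {..<m} <+> {..<n}"

lemma edges_two_cycles: "edges (two_cycles m n) = union_edge m n ` edge_indices m n"
proof -
  have "edges (cycle_graph k) = (\<lambda>i. {i, (i + 1) mod k}) ` {..<k}" for k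
    by (auto simp: cycle_graph_def)
  then show ?thesis
    by (simp add: disjoint_union_def Plus_def image_Un image_image union_edge_def)
qed

lemma inj_on_cycle_edge:
  assumes "3 \<le> k"
  shows "inj_on (\<lambda>i::nat. {i, (i + 1) mod k}) {..<k}"
proof (rule inj_onI)
  fix i j :: nat assume ij: "i \<in> {..<k}" "j \<in> {..<k}" "{i, (i + 1) mod k} = {j, (j + 1) mod k}"
  show "i = j"
  proof (rule ccontr)
    assume "i \<noteq> j"
    with ij(3) have "i = (j + 1) mod k" "j = (i + 1) mod k"
      by (auto simp: doubleton_eq_iff)
    moreover have "(l + 1) mod k = 0 \<and> Suc l = k \<or> (l + 1) mod k = Suc l" if "l < k" for l
      using that by (cases "Suc l = k") auto
    ultimately have "i = 0 \<and> Suc j = k \<or> i = Suc j" "j = 0 \<and> Suc i = k \<or> j = Suc i"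
      using ij(1,2) by (metis lessThan_iff)+
    with assms show False
      by presburger
  qed
qed

lemma inj_on_union_edge:
  assumes "3 \<le> m" "3 \<le> n"
  shows "inj_on (union_edge m n) (edge_indices m n)"
proof (rule inj_onI)
  fix \<iota> \<kappa>
  assume \<iota>\<kappa>: "\<iota> \<in> edge_indices m n" "\<kappa> \<in> edge_indices m n"
    and eq: "union_edge m n \<iota> = union_edge m n \<kappa>"
  have image: "union_edge m n (Inl i) = Inl ` {i, (i + 1) mod m}"
    "union_edge m n (Inr i) = Inr ` {i, (i + 1) mod n}" for i
    by (simp_all add: union_edge_def)
  from \<iota>\<kappa> show "\<iota> = \<kappa>"
  proof (elim PlusE)
    fix i j assume "i \<in> {..<m}" "j \<in> {..<m}" "\<iota> = Inl i" "\<kappa> = Inl j"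
    then show ?thesis
      using eq inj_onD[OF inj_on_cycle_edge[OF assms(1)], of i j]
      by (simp only: image inj_image_eq_iff[OF inj_Inl])
  next
    fix i j assume "i \<in> {..<n}" "j \<in> {..<n}" "\<iota> = Inr i" "\<kappa> = Inr j"
    then show ?thesis
      using eq inj_onD[OF inj_on_cycle_edge[OF assms(2)], of i j]
      by (simp only: image inj_image_eq_iff[OF inj_Inr])
  qed (use eq in \<open>auto simp: union_edge_def\<close>)
qed

text \<open>
  The increments of an injective closed walk through \<open>k\<close> points of the line. Only arcs avoiding the
  last increment are mentioned: the complement of any other proper arc is one of these, and
  its sum is the negative.
\<close>

definition simple_closed_increments :: "nat \<Rightarrow> (nat \<Rightarrow> real) \<Rightarrow> bool" where
  "simple_closed_increments k a \<longleftrightarrow> (\<Sum>i<k. a i) = 0 \<and> (\<forall>j<k. \<forall>i<j. (\<Sum>l=i..<j. a l) \<noteq> 0)"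

lemma inj_on_partial_sums:
  assumes "simple_closed_increments k a"
  shows "inj_on (\<lambda>i. \<Sum>l<i. a l) {..<k}"
proof (rule linorder_inj_onI)
  fix i j assume "i < j" "i \<in> {..<k}" "j \<in> {..<k}"
  moreover have "(\<Sum>l<j. a l) = (\<Sum>l<i. a l) + (\<Sum>l=i..<j. a l)"
    using \<open>i < j\<close> by (simp add: lessThan_atLeast0 sum.atLeastLessThan_concat)
  ultimately show "(\<Sum>l<i. a l) \<noteq> (\<Sum>l<j. a l)"
    using assms by (auto simp: simple_closed_increments_def)
qed auto

lemma partial_sums_edge:
  assumes "simple_closed_increments k a" "i < k"
  shows "\<bar>(\<Sum>l<i. a l) - (\<Sum>l<(i + 1) mod k. a l)\<bar> = \<bar>a i\<bar>"
proof (cases "Suc i = k")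
  case True
  then show ?thesis
    using assms(1) by (auto simp: simple_closed_increments_def)
next
  case False
  then show ?thesis
    using assms(2) by simp
qed

text \<open>
  Place the vertices of each cycle at the partial sums of its increments, and shift the second
  cycle by a constant \<open>K\<close> that avoids the finitely many collisions with the first one.
\<close>

lemma order_realizable_two_cyclesI:
  assumes r: "strict_linear_order_on (edges (two_cycles m n)) r"
    and a: "simple_closed_increments m a" and b: "simple_closed_increments n b"
    and less: "\<And>\<iota> \<kappa>. \<iota> \<in> edge_indices m n \<Longrightarrow> \<kappa> \<in> edge_indices m n \<Longrightarrow>
      (union_edge m n \<iota>, union_edge m n \<kappa>) \<in> r \<Longrightarrow> \<bar>case_sum a b \<iota>\<bar> < \<bar>case_sum a b \<kappa>\<bar>"
  shows "order_realizable (two_cycles m n) r"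
proof -
  define P where "P i = (\<Sum>l<i. a l)" for i
  define Q where "Q i = (\<Sum>l<i. b l)" for i
  obtain K where K: "K \<notin> (\<lambda>(i, j). P i - Q j) ` ({..<m} \<times> {..<n})"
    using ex_new_if_finite[of "(\<lambda>(i, j). P i - Q j) ` ({..<m} \<times> {..<n})"] infinite_UNIV_char_0
    by blast
  define p where "p = case_sum P (\<lambda>j. K + Q j)"
  have cross: "P i \<noteq> K + Q j" if "i < m" "j < n" for i j
    using K that by force
  have "inj_on P {..<m}" "inj_on Q {..<n}"
    using inj_on_partial_sums a b unfolding P_def Q_def by blast+
  then have inj: "inj_on p (verts (two_cycles m n))"
    using cross cross[symmetric]
    by (auto simp: inj_on_def p_def disjoint_union_def cycle_graph_def)
  have length: "\<bar>p u - p v\<bar> = \<bar>case_sum a b \<iota>\<bar>"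
    if "\<iota> \<in> edge_indices m n" "{u, v} = union_edge m n \<iota>" for u v \<iota>
    using that partial_sums_edge[OF a] partial_sums_edge[OF b]
    by (auto simp: union_edge_def doubleton_eq_iff p_def P_def Q_def abs_minus_commute)
  have mono: "\<bar>p u - p v\<bar> < \<bar>p x - p y\<bar>"
    if edges: "{u, v} \<in> edges (two_cycles m n)" "{x, y} \<in> edges (two_cycles m n)"
      and uvxy: "({u, v}, {x, y}) \<in> r" for u v x y
  proof -
    obtain \<iota> where \<iota>: "{u, v} = union_edge m n \<iota>" "\<iota> \<in> edge_indices m n"
      using edges(1) unfolding edges_two_cycles by (rule imageE)
    obtain \<kappa> where \<kappa>: "{x, y} = union_edge m n \<kappa>" "\<kappa> \<in> edge_indices m n"
      using edges(2) unfolding edges_two_cycles by (rule imageE)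
    show ?thesis
      using less[OF \<iota>(2) \<kappa>(2)] uvxy
      unfolding length[OF \<iota>(2,1)] length[OF \<kappa>(2,1)] \<iota>(1) \<kappa>(1) by blast
  qed
  have total: "(e, f) \<in> r \<or> (f, e) \<in> r"
    if "e \<in> edges (two_cycles m n)" "f \<in> edges (two_cycles m n)" "e \<noteq> f" for e f
    using r that unfolding strict_linear_order_on_def total_on_def by auto
  have "\<bar>p u - p v\<bar> \<noteq> \<bar>p x - p y\<bar> \<and>
      (({u, v}, {x, y}) \<in> r \<longleftrightarrow> \<bar>p u - p v\<bar> < \<bar>p x - p y\<bar>)"
    if edges: "{u, v} \<in> edges (two_cycles m n)" "{x, y} \<in> edges (two_cycles m n)"
      and neq: "{u, v} \<noteq> {x, y}" for u v x y
    using total[OF edges neq]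
  proof
    assume "({u, v}, {x, y}) \<in> r"
    with mono[OF edges] show ?thesis
      by linarith
  next
    assume "({x, y}, {u, v}) \<in> r"
    then have "\<bar>p x - p y\<bar> < \<bar>p u - p v\<bar>"
      by (rule mono[OF edges(2,1)])
    with mono[OF edges] show ?thesis
      by linarith
  qed
  with inj show ?thesis
    unfolding order_realizable_def by (intro exI[of _ p]) simp
qed

text \<open>
  A direction of perturbation that keeps the total sum \<open>0\<close>, while every arc that avoids the last
  index has positive slope, namely its number of edges.
\<close>

definition tilt :: "nat \<Rightarrow> nat \<Rightarrow> real" where
  "tilt k i = (if Suc i = k then 1 - real k else 1)"

lemma eventually_nonzero_shift:
  assumes "0 < (q :: real)"
  shows "eventually (\<lambda>\<epsilon>. s + \<epsilon> * q \<noteq> 0) (at_right 0)"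
proof (cases "s = 0")
  case True
  then show ?thesis
    using eventually_at_right_less[of "0 :: real"] assms by (auto elim: eventually_mono)
next
  case False
  have "((\<lambda>\<epsilon>. s + \<epsilon> * q) \<longlongrightarrow> s + 0 * q) (at_right 0)"
    by (intro tendsto_intros)
  then show ?thesis
    using False by (intro tendsto_imp_eventually_ne) auto
qed

text \<open>
  Each of the finitely many arc sums is a non-constant affine function of \<open>\<epsilon>\<close>, so it does not
  vanish for small positive \<open>\<epsilon>\<close>.
\<close>

lemma eventually_simple_closed_increments:
  assumes "(\<Sum>i<k. a i) = 0" "0 < k"
  shows "eventually (\<lambda>\<epsilon>. simple_closed_increments k (\<lambda>i. a i + \<epsilon> * tilt k i)) (at_right 0)"
proof -
  obtain k' where k: "k = Suc k'"
    using assms(2) by (cases k) auto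
  have "(\<Sum>i<k. tilt k i) = 0"
    by (simp add: k tilt_def)
  then have total: "(\<Sum>i<k. a i + \<epsilon> * tilt k i) = 0" for \<epsilon>
    using assms(1) by (simp add: sum.distrib flip: sum_distrib_left)
  have arc: "(\<Sum>l=i..<j. a l + \<epsilon> * tilt k l) = (\<Sum>l=i..<j. a l) + \<epsilon> * real (j - i)"
    if "j < k" "i < j" for i j \<epsilon>
  proof -
    have "(\<Sum>l=i..<j. tilt k l) = (\<Sum>l=i..<j. 1)"
      using that by (intro sum.cong) (auto simp: tilt_def)
    then show ?thesis
      by (simp add: sum.distrib flip: sum_distrib_left)
  qed
  have "eventually (\<lambda>\<epsilon>. \<forall>j\<in>{..<k}. \<forall>i\<in>{..<j}. (\<Sum>l=i..<j. a l) + \<epsilon> * real (j - i) \<noteq> 0)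
    (at_right 0)"
    by (intro eventually_ball_finite ballI eventually_nonzero_shift) auto
  then show ?thesis
    by (rule eventually_mono) (auto simp: simple_closed_increments_def total arc)
qed

text \<open>
  The order is expressed by finitely many strict inequalities between absolute values, which
  survive a small perturbation.
\<close>

lemma order_realizable_of_balanced_lengths:
  fixes a b :: "nat \<Rightarrow> real"
  assumes r: "strict_linear_order_on (edges (two_cycles m n)) r"
    and "0 < m" "0 < n" and a: "(\<Sum>i<m. a i) = 0" and b: "(\<Sum>i<n. b i) = 0"
    and less: "\<And>\<iota> \<kappa>. \<iota> \<in> edge_indices m n \<Longrightarrow> \<kappa> \<in> edge_indices m n \<Longrightarrow>
      (union_edge m n \<iota>, union_edge m n \<kappa>) \<in> r \<Longrightarrow> \<bar>case_sum a b \<iota>\<bar> < \<bar>case_sum a b \<kappa>\<bar>"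
  shows "order_realizable (two_cycles m n) r"
proof -
  define a' where "a' \<epsilon> i = a i + \<epsilon> * tilt m i" for \<epsilon> i
  define b' where "b' \<epsilon> i = b i + \<epsilon> * tilt n i" for \<epsilon> i
  define I where "I = edge_indices m n"
  have lim: "((\<lambda>\<epsilon>. \<bar>case_sum (a' \<epsilon>) (b' \<epsilon>) \<iota>\<bar>) \<longlongrightarrow> \<bar>case_sum a b \<iota>\<bar>) (at_right 0)" for \<iota>
  proof -
    define t where "t = case_sum (tilt m) (tilt n) \<iota>"
    have "((\<lambda>\<epsilon>. \<bar>case_sum a b \<iota> + \<epsilon> * t\<bar>) \<longlongrightarrow> \<bar>case_sum a b \<iota> + 0 * t\<bar>) (at_right 0)"
      by (intro tendsto_intros)
    then show ?thesis
      by (cases \<iota>) (simp_all add: a'_def b'_def t_def)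
  qed
  have "eventually (\<lambda>\<epsilon>. \<forall>\<iota>\<in>I. \<forall>\<kappa>\<in>I. (union_edge m n \<iota>, union_edge m n \<kappa>) \<in> r \<longrightarrow>
    \<bar>case_sum (a' \<epsilon>) (b' \<epsilon>) \<iota>\<bar> < \<bar>case_sum (a' \<epsilon>) (b' \<epsilon>) \<kappa>\<bar>) (at_right 0)"
  proof (intro eventually_ball_finite ballI)
    fix \<iota> \<kappa> assume "\<iota> \<in> I" "\<kappa> \<in> I"
    show "eventually (\<lambda>\<epsilon>. (union_edge m n \<iota>, union_edge m n \<kappa>) \<in> r \<longrightarrow>
        \<bar>case_sum (a' \<epsilon>) (b' \<epsilon>) \<iota>\<bar> < \<bar>case_sum (a' \<epsilon>) (b' \<epsilon>) \<kappa>\<bar>) (at_right 0)"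
    proof (cases "(union_edge m n \<iota>, union_edge m n \<kappa>) \<in> r")
      case True
      then have "0 < \<bar>case_sum a b \<kappa>\<bar> - \<bar>case_sum a b \<iota>\<bar>"
        using less[of \<iota> \<kappa>] \<open>\<iota> \<in> I\<close> \<open>\<kappa> \<in> I\<close> unfolding I_def by linarith
      from order_tendstoD(1)[OF tendsto_diff[OF lim lim] this] show ?thesis
        by (rule eventually_mono) simp
    qed simp
  qed (auto simp: I_def)
  moreover have "eventually (\<lambda>\<epsilon>. simple_closed_increments m (a' \<epsilon>)) (at_right 0)"
    "eventually (\<lambda>\<epsilon>. simple_closed_increments n (b' \<epsilon>)) (at_right 0)"
    using eventually_simple_closed_increments a b assms(2,3) unfolding a'_def b'_def by auto
  ultimately have "eventually (\<lambda>\<epsilon>. simple_closed_increments m (a' \<epsilon>) \<and> simple_closed_increments n (b' \<epsilon>) \<and>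
    (\<forall>\<iota>\<in>I. \<forall>\<kappa>\<in>I. (union_edge m n \<iota>, union_edge m n \<kappa>) \<in> r \<longrightarrow>
    \<bar>case_sum (a' \<epsilon>) (b' \<epsilon>) \<iota>\<bar> < \<bar>case_sum (a' \<epsilon>) (b' \<epsilon>) \<kappa>\<bar>)) (at_right 0)"
    by (intro eventually_conj)
  then obtain \<epsilon> where "simple_closed_increments m (a' \<epsilon>)" "simple_closed_increments n (b' \<epsilon>)"
    "\<forall>\<iota>\<in>I. \<forall>\<kappa>\<in>I. (union_edge m n \<iota>, union_edge m n \<kappa>) \<in> r \<longrightarrow>
      \<bar>case_sum (a' \<epsilon>) (b' \<epsilon>) \<iota>\<bar> < \<bar>case_sum (a' \<epsilon>) (b' \<epsilon>) \<kappa>\<bar>"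
    using eventually_happens by force
  then show ?thesis
    using order_realizable_two_cyclesI[OF r] by (auto simp: I_def)
qed

section \<open>Every order on larger cycles\<close>

text \<open>
  The rank of an element is the number of elements above it, so that the maximum has rank \<open>0\<close>.
\<close>

lemma descending_rank:
  assumes "finite E" "strict_linear_order_on E r"
  shows "\<exists>rk. bij_betw rk E {..<card E} \<and>
    (\<forall>x\<in>E. \<forall>y\<in>E. (x, y) \<in> r \<longrightarrow> rk y < rk x)"
proof -
  have "trans r" "irrefl r" "total_on E r"
    using assms(2) by (auto simp: strict_linear_order_on_def)
  define rk where "rk x = card {z \<in> E. (z, x) \<in> r\<inverse>}" for x
  have less: "rk y < rk x" if "x \<in> E" "y \<in> E" "(x, y) \<in> r" for x y
    unfolding rk_def
  proof (rule psubset_card_mono)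
    show "{z \<in> E. (z, y) \<in> r\<inverse>} \<subset> {z \<in> E. (z, x) \<in> r\<inverse>}"
      using that \<open>trans r\<close> \<open>irrefl r\<close> by (auto dest: transD simp: irrefl_def)
  qed (use assms(1) in auto)
  have "rk x < card E" if "x \<in> E" for x
    unfolding rk_def
    using that assms(1) \<open>irrefl r\<close> by (intro psubset_card_mono) (auto simp: irrefl_def)
  moreover have inj: "inj_on rk E"
    using less \<open>total_on E r\<close> unfolding inj_on_def total_on_def by (metis less_irrefl)
  ultimately have "rk ` E = {..<card E}"
    using assms(1) by (intro card_subset_eq) (auto simp: card_image)
  with inj less show ?thesis
    by (auto simp: bij_betw_def intro!: exI[of _ rk])
qed

lemma realizable_two_cycles:
  assumes "3 \<le> m" "3 \<le> n" "(m, n) \<noteq> (3, 3)"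
  shows "realizable (two_cycles m n)"
  unfolding realizable_def
proof (intro allI impI)
  fix r assume r: "strict_linear_order_on (edges (two_cycles m n)) r"
  let ?E = "edges (two_cycles m n)" and ?I = "edge_indices m n"
  define e where "e = union_edge m n"
  have e: "bij_betw e ?I ?E"
    using inj_on_union_edge[OF assms(1,2)] by (simp add: bij_betw_def edges_two_cycles e_def)
  then have card: "card ?E = m + n" and fin: "finite ?E"
    using bij_betw_same_card[OF e] bij_betw_finite[OF e] by (auto simp: card_Plus)
  obtain rk where rk: "bij_betw rk ?E {..<m + n}"
    and less: "\<And>x y. x \<in> ?E \<Longrightarrow> y \<in> ?E \<Longrightarrow> (x, y) \<in> r \<Longrightarrow> rk y < rk x"
    using descending_rank[OF fin r] card by auto
  define \<rho> where "\<rho> = rk \<circ> e"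
  have \<rho>: "bij_betw \<rho> ?I {..<m + n}"
    unfolding \<rho>_def using bij_betw_trans[OF e rk] .
  then have inj: "inj_on \<rho> ?I" and im: "\<rho> ` ?I = {..<m + n}"
    by (auto simp: bij_betw_def)
  define c where "c t \<longleftrightarrow> t \<in> \<rho> ` Inl ` {..<m}" for t
  have injl: "inj_on (\<rho> \<circ> Inl) {..<m}" and injr: "inj_on (\<rho> \<circ> Inr) {..<n}"
    using inj by (auto simp: inj_on_def)
  have cl: "{t. t < m + n \<and> c t} = (\<rho> \<circ> Inl) ` {..<m}"
    using im by (auto simp: c_def)
  have cr: "{t. t < m + n \<and> \<not> c t} = (\<rho> \<circ> Inr) ` {..<n}"
  proof -
    define A B where "A = \<rho> ` Inl ` {..<m}" and "B = \<rho> ` Inr ` {..<n}"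
    have "A \<inter> B = {}"
      using inj by (auto simp: inj_on_def A_def B_def)
    moreover have "{..<m + n} = A \<union> B"
      using im by (simp add: Plus_def image_Un A_def B_def)
    moreover have "{t. t < m + n \<and> \<not> c t} = {..<m + n} - A"
      by (auto simp: c_def A_def)
    ultimately have "{t. t < m + n \<and> \<not> c t} = B"
      by blast
    then show ?thesis
      by (simp add: B_def image_comp)
  qed
  have hits: "hits c (m + n) = m" "hits (\<lambda>i. \<not> c i) (m + n) = n"
    unfolding hits_def cl cr using card_image[OF injl] card_image[OF injr] by auto
  have "3 \<le> hits c (m + n)" "3 \<le> hits (\<lambda>i. \<not> c i) (m + n)"
    "\<not> (hits c (m + n) = 3 \<and> hits (\<lambda>i. \<not> c i) (m + n) = 3)"
    unfolding hits using assms by simp_all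
  from balanced_lengths[OF this] obtain l :: "nat \<Rightarrow> real" where
    l: "\<forall>i j. i < j \<and> j < m + n \<longrightarrow> \<bar>l j\<bar> < \<bar>l i\<bar>"
    and sums: "(\<Sum>i | i < m + n \<and> c i. l i) = 0" "(\<Sum>i | i < m + n \<and> \<not> c i. l i) = 0"
    by (elim exE conjE)
  show "order_realizable (two_cycles m n) r"
  proof (rule order_realizable_of_balanced_lengths[OF r])
    show "(\<Sum>i<m. l (\<rho> (Inl i))) = 0" "(\<Sum>i<n. l (\<rho> (Inr i))) = 0"
      using sums unfolding cl cr sum.reindex[OF injl] sum.reindex[OF injr] by simp_all
    fix \<iota> \<kappa> assume "\<iota> \<in> ?I" "\<kappa> \<in> ?I" "(union_edge m n \<iota>, union_edge m n \<kappa>) \<in> r"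
    then have "\<rho> \<kappa> < \<rho> \<iota>" "\<rho> \<iota> < m + n"
      using less im by (auto simp: \<rho>_def e_def edges_two_cycles)
    with l have "\<bar>l (\<rho> \<iota>)\<bar> < \<bar>l (\<rho> \<kappa>)\<bar>"
      by simp
    then show "\<bar>case_sum (\<lambda>i. l (\<rho> (Inl i))) (\<lambda>i. l (\<rho> (Inr i))) \<iota>\<bar>
        < \<bar>case_sum (\<lambda>i. l (\<rho> (Inl i))) (\<lambda>i. l (\<rho> (Inr i))) \<kappa>\<bar>"
      by (cases \<iota>; cases \<kappa>) simp_all
  qed (use assms in auto)
qed

section \<open>Two triangles\<close>

lemma strict_linear_order_on_list:
  assumes "distinct xs"
  shows "strict_linear_order_on (set xs) {(xs ! i, xs ! j) | i j. i < j \<and> j < length xs}"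
    (is "strict_linear_order_on _ ?r")
  unfolding strict_linear_order_on_def
proof (intro conjI)
  show "trans ?r"
  proof (rule transI)
    fix x y z assume "(x, y) \<in> ?r" "(y, z) \<in> ?r"
    then obtain i j k l where "x = xs ! i" "y = xs ! j" "i < j" "j < length xs"
      "y = xs ! k" "z = xs ! l" "k < l" "l < length xs"
      by blast
    moreover from this have "j = k"
      using assms by (simp add: nth_eq_iff_index_eq)
    ultimately have "x = xs ! i \<and> z = xs ! l \<and> i < l \<and> l < length xs"
      by simp
    then show "(x, z) \<in> ?r"
      by blast
  qed
  show "irrefl ?r"
    using assms by (auto simp: irrefl_def nth_eq_iff_index_eq)
  show "total_on (set xs) ?r"
    unfolding total_on_def
  proof (intro ballI impI)
    fix x y assume "x \<in> set xs" "y \<in> set xs" "x \<noteq> y"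
    then obtain i j where "i < length xs" "j < length xs" "x = xs ! i" "y = xs ! j" "i \<noteq> j"
      by (metis in_set_conv_nth)
    then show "(x, y) \<in> ?r \<or> (y, x) \<in> ?r"
      by (cases "i < j") auto
  qed
qed

text \<open>
  In the list \<open>L\<close>, from the shortest to the longest edge, the two shorter sides of the first
  triangle are dominated by those of the second, but the longest sides compare the other way.
\<close>

lemma not_realizable_two_triangles: "\<not> realizable (two_cycles 3 3)"
proof
  assume realizable: "realizable (two_cycles 3 3)"
  define a where "a i j = {Inl i, Inl j :: nat + nat}" for i j
  define b where "b i j = {Inr i, Inr j :: nat + nat}" for i j
  define L where "L = [a 0 1, b 0 1, a 1 2, b 1 2, b 2 0, a 2 0]"
  define r where "r = {(L ! i, L ! j) | i j. i < j \<and> j < length L}"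
  have "edge_indices 3 3 = {Inl 0, Inl 1, Inl 2, Inr 0, Inr 1, Inr 2}"
    by (simp add: Plus_def lessThan_nat_numeral lessThan_Suc insert_commute)
  moreover have "union_edge 3 3 (Inl 0) = a 0 1" "union_edge 3 3 (Inl 1) = a 1 2"
    "union_edge 3 3 (Inl 2) = a 2 0" "union_edge 3 3 (Inr 0) = b 0 1"
    "union_edge 3 3 (Inr 1) = b 1 2" "union_edge 3 3 (Inr 2) = b 2 0"
    by (simp_all add: union_edge_def a_def b_def numeral_2_eq_2)
  ultimately have E: "edges (two_cycles 3 3) = set L"
    unfolding edges_two_cycles by (simp only: image_insert image_empty L_def list.set) blast
  have "a i j = a k l \<longleftrightarrow> i = k \<and> j = l \<or> i = l \<and> j = k" "a i j \<noteq> b k l" "b k l \<noteq> a i j"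
    "b i j = b k l \<longleftrightarrow> i = k \<and> j = l \<or> i = l \<and> j = k" for i j k l
    by (simp_all add: a_def b_def doubleton_eq_iff)
  then have "distinct L"
    by (simp add: L_def)
  then have "strict_linear_order_on (edges (two_cycles 3 3)) r"
    unfolding E r_def by (rule strict_linear_order_on_list)
  moreover have "r \<subseteq> edges (two_cycles 3 3) \<times> edges (two_cycles 3 3)"
    unfolding E r_def by auto
  ultimately have "order_realizable (two_cycles 3 3) r"
    using realizable unfolding realizable_def by simp
  then obtain p :: "nat + nat \<Rightarrow> real" where p: "\<forall>u v x y. {u, v} \<in> set L \<longrightarrow>
    {x, y} \<in> set L \<longrightarrow> {u, v} \<noteq> {x, y} \<longrightarrow> \<bar>p u - p v\<bar> \<noteq> \<bar>p x - p y\<bar> \<and>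
      (({u, v}, {x, y}) \<in> r \<longleftrightarrow> \<bar>p u - p v\<bar> < \<bar>p x - p y\<bar>)"
    unfolding order_realizable_def E by (elim exE conjE)
  have less: "\<bar>p u - p v\<bar> < \<bar>p x - p y\<bar>"
    if uv: "{u, v} = L ! i" and xy: "{x, y} = L ! j" and ij: "i < j" "j < length L" for i j u v x y
  proof -
    have "(L ! i, L ! j) \<in> r"
      unfolding r_def using ij by blast
    moreover have "L ! i \<in> set L" "L ! j \<in> set L" "L ! i \<noteq> L ! j"
      using ij \<open>distinct L\<close> by (simp_all add: nth_eq_iff_index_eq)
    ultimately show ?thesis
      using p[rule_format, of u v x y] unfolding uv xy by simp
  qed
  let ?A = "\<lambda>i j. \<bar>p (Inl i) - p (Inl j)\<bar>" and ?B = "\<lambda>i j. \<bar>p (Inr i) - p (Inr j)\<bar>"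
  have "?A 0 1 < ?B 0 1"
    by (rule less[of _ _ 0 _ _ 1]) (simp_all add: L_def a_def b_def)
  moreover have "?A 1 2 < ?B 1 2"
    by (rule less[of _ _ 2 _ _ 3]) (simp_all add: L_def a_def b_def)
  moreover have "?B 0 1 < ?B 2 0"
    by (rule less[of _ _ 1 _ _ 4]) (simp_all add: L_def a_def b_def)
  moreover have "?B 1 2 < ?B 2 0"
    by (rule less[of _ _ 3 _ _ 4]) (simp_all add: L_def a_def b_def)
  moreover have "?B 2 0 < ?A 2 0"
    by (rule less[of _ _ 4 _ _ 5]) (simp_all add: L_def a_def b_def)
  \<comment> \<open>As the longest side, \<open>?B 2 0\<close> equals \<open>?B 0 1 + ?B 1 2\<close>, whereas \<open>?A 2 0\<close> is at most
    \<open>?A 0 1 + ?A 1 2\<close> by the triangle inequality.\<close>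
  ultimately show False
    by linarith
qed

theorem theorem3:
  fixes m n :: nat
  assumes "3 \<le> m" and "3 \<le> n"
  shows "realizable (disjoint_union (cycle_graph m) (cycle_graph n)) \<longleftrightarrow> (m, n) \<noteq> (3, 3)"
  using realizable_two_cycles[OF assms] not_realizable_two_triangles by auto

end
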